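(* Let $s\ge 1$ and $m\ge 4s+2$ be integers. Then there exists a supersequence of size (length) at most $$\left\lceil m^2-\frac{5s-3}{2s-1}\,m+\frac{4s^3-10s^2+21s-11}{2s-1}\right\rceil$$ over a set of $m$ letters.
   Context: A supersequence over a finite set $A$ is a finite sequence of elements of $A$ that contains every permutation of $A$ (every sequence listing each element of $A$ exactly once) as a subsequence, i.e. each permutation can be obtained from it by deleting zero or more elements and keeping the order of the others. The size of a sequence is its length. *)

theory Defs
  imports Complex_Main "HOL-Library.Sublist" "HOL-Combinatorics.Multiset_Permutations"
begin

definition supersequence :: "'a set \<Rightarrow> 'a list \<Rightarrow> bool" where
  "supersequence A w \<longleftrightarrow>
     finite A \<and> set w \<subseteq> A \<and> (\<forall>p \<in> permutations_of_set A. subseq p w)"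

end

theory Submission
  imports Defs
begin

text \<open>
  Single out one letter \<open>x\<close> and \<open>w = s - 1\<close> skip letters \<open>vs\<close>, and repeat the remaining
  \<open>N + 1\<close> letters \<open>bs\<close> cyclically. Cut this cyclic sequence into rows of length \<open>N\<close>. The letter \<open>x\<close>
  is inserted in every row at offset \<open>w\<close>. The block \<open>vs\<close> is inserted at offsets
  \<open>0, \<dots>, w - 1, w + 1, \<dots>, 2 w\<close> of \<open>2 w\<close> consecutive rows and skipped in the next row, with
  period \<open>2 w + 1\<close>.

  Embed a permutation greedily. A cyclic letter costs at most one row, as it differs from its
  predecessors. Since the offset of \<open>vs\<close> rises through all values but \<open>w\<close>, a skip letter costs at
  most one row and one unit of offset. Thus the offset stays at most \<open>w\<close> before \<open>x\<close> is reached, so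
  that \<open>x\<close> costs no row; it raises the offset by at most \<open>w + 1\<close>, which leaves the offset at most
  \<open>2 w\<close> whenever a further skip letter is requested. In total \<open>m - 1\<close> rows and \<open>2 w + 1\<close> further
  cyclic letters suffice, and the skipped rows shorten the word.
\<close>

lemma subseq_snoc:
  assumes "subseq p u" and "c \<in> set v"
  shows "subseq (p @ [c]) (u @ v)"
  using assms by (intro list_emb_append_mono) (auto simp: subseq_singleton_left)

lemma subseq_snoc_notin:
  assumes "subseq p (u @ [c])" and "c \<notin> set p"
  shows "subseq p u"
proof -
  have "subseq (filter (\<lambda>y. y \<noteq> c) p) (filter (\<lambda>y. y \<noteq> c) (u @ [c]))"
    using assms(1) by (rule subseq_filter)
  moreover have "filter (\<lambda>y. y \<noteq> c) p = p"
    using assms(2) by (intro filter_True) blast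
  ultimately have "subseq p (filter (\<lambda>y. y \<noteq> c) u)"
    by simp
  then show ?thesis
    using subseq_filter_left by (rule subseq_order.trans)
qed

text \<open>Each complete period of \<open>Suc T\<close> rows lacks one summand \<open>w\<close>, in
  its last row; an incomplete final period lacks none.\<close>

lemma sum_skipped_rows:
  fixes T m w :: nat
  shows "(\<Sum>j<m. if j mod Suc T < T then w else 0) + w * (m div Suc T) = w * m"
proof (induction m)
  case (Suc m)
  have "m mod Suc T < T \<or> m mod Suc T = T"
    using mod_less_divisor[of "Suc T" m] by linarith
  then show ?case
    using Suc by (auto simp: div_Suc mod_Suc algebra_simps)
qed simp

section \<open>Construction of the word\<close>

locale skip_word =
  fixes bs vs :: "'a list" and x :: 'a and N w :: nat
  assumes length_bs: "length bs = Suc N" and length_vs: "length vs = w"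
    and distinct_letters: "distinct (x # vs @ bs)"
    and room: "2 * w < N"
begin

definition base :: "nat \<Rightarrow> 'a" where
  "base i = bs ! (i mod Suc N)"

definition offset :: "nat \<Rightarrow> nat" where
  "offset e = (if e < w then e else Suc e)"

definition age :: "nat \<Rightarrow> nat" where
  "age j = j mod Suc (2 * w)"

definition row_gap :: "nat \<Rightarrow> nat \<Rightarrow> 'a list" where
  "row_gap j r = (if r = w then [x] else []) @
     (if age j < 2 * w \<and> r = offset (age j) then vs else [])"

definition gap :: "nat \<Rightarrow> 'a list" where
  "gap h = row_gap (h div N) (h mod N)"

text \<open>Indexed by the last cyclic letter: \<open>gap q\<close> comes after
  \<open>word q\<close>, so a letter of \<open>gap h\<close> is available only from index
  \<open>h + 1\<close> on.\<close>

primrec word :: "nat \<Rightarrow> 'a list" where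
  "word 0 = [base 0]"
| "word (Suc q) = word q @ gap q @ [base (Suc q)]"

lemma age_le: "age j \<le> 2 * w"
  unfolding age_def using mod_less_divisor[of "Suc (2 * w)" j] by linarith

lemma age_Suc: "age (Suc j) = (if age j = 2 * w then 0 else Suc (age j))"
  unfolding age_def by (simp add: mod_Suc)

lemma offset_le: "e < 2 * w \<Longrightarrow> offset e \<le> 2 * w"
  by (simp add: offset_def)

lemma gap_eq: "r < N \<Longrightarrow> gap (j * N + r) = row_gap j r"
  by (simp add: gap_def)

lemma base_in: "base i \<in> set bs"
  unfolding base_def by (rule nth_mem) (simp add: length_bs)

lemma set_word: "set (word q) \<subseteq> set (x # vs @ bs)"
proof (induction q)
  case (Suc q)
  have "set (gap q) \<subseteq> set (x # vs)"
    unfolding gap_def row_gap_def by (split if_split)+ auto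
  then show ?case
    using Suc base_in[of "Suc q"] by auto
qed (use base_in in auto)

lemma word_mono: "q \<le> r \<Longrightarrow> subseq (word q) (word r)"
proof (induction r)
  case (Suc r)
  then show ?case
    by (cases "q = Suc r") auto
qed simp

section \<open>Cost of a single greedy step\<close>

lemma base_occurs:
  assumes "c \<in> set bs"
  obtains i where "q \<le> i" "i \<le> q + N" "base i = c"
proof -
  obtain a where a: "a < Suc N" "bs ! a = c"
    using assms unfolding in_set_conv_nth length_bs by auto
  \<comment> \<open>Forward distance from \<open>q\<close> to the next index congruent to
    \<open>a\<close>; the added \<open>Suc N\<close> prevents truncated subtraction.\<close>
  define d where "d = (a + Suc N - q mod Suc N) mod Suc N"
  have "q mod Suc N < Suc N"
    by simp
  then have "(q + d) mod Suc N = (q mod Suc N + (a + Suc N - q mod Suc N)) mod Suc N"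
    unfolding d_def by (simp only: mod_add_left_eq mod_add_right_eq)
  also have "q mod Suc N + (a + Suc N - q mod Suc N) = a + Suc N"
    using \<open>q mod Suc N < Suc N\<close> by linarith
  also have "(a + Suc N) mod Suc N = a"
    using a(1) by (simp only: mod_add_self2 mod_less)
  finally have "base (q + d) = c"
    using a by (simp add: base_def)
  moreover have "d < Suc N"
    unfolding d_def by (rule mod_less_divisor) simp
  ultimately show thesis
    using that[of "q + d"] by auto
qed

text \<open>Positions \<open>q\<close> to \<open>q + N\<close> run through all of \<open>bs\<close>.
  Allowing position \<open>q\<close> itself keeps the cost at \<open>N\<close> instead of
  \<open>N + 1\<close>.\<close>

lemma subseq_snoc_base:
  assumes "subseq p (word q)" and "c \<in> set bs" and "c \<notin> set p"
  shows "subseq (p @ [c]) (word (q + N))"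
proof -
  obtain i where i: "q \<le> i" "i \<le> q + N" "base i = c"
    using base_occurs[OF assms(2), of q] .
  have "subseq (p @ [c]) (word i)"
  proof (cases "i = q")
    case True
    obtain u where u: "word q = u @ [c]"
    proof (cases q)
      case 0
      then show thesis
        using that[of "[]"] i True by simp
    next
      case (Suc r)
      then show thesis
        using that[of "word r @ gap r"] i True by simp
    qed
    \<comment> \<open>As \<open>c\<close> is not in \<open>p\<close>, the last letter of \<open>word q\<close> is still free.\<close>
    have "subseq p u"
      using subseq_snoc_notin assms(1,3) unfolding u .
    then show ?thesis
      unfolding True u by (rule subseq_snoc) simp
  next
    case False
    then obtain r where r: "i = Suc r" "q \<le> r"
      using i by (cases i) auto
    have "subseq p (word r)"
      using assms(1) word_mono[OF r(2)] by (rule subseq_order.trans)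
    then show ?thesis
      using i(3) unfolding r word.simps by (intro subseq_snoc) auto
  qed
  then show ?thesis
    using word_mono[OF i(2)] by (rule subseq_order.trans)
qed

lemma subseq_snoc_gap:
  assumes "subseq p (word q)" and "q \<le> h" and "h < r" and "c \<in> set (gap h)"
  shows "subseq (p @ [c]) (word r)"
proof -
  have "subseq p (word h)"
    using assms(1) word_mono[OF assms(2)] by (rule subseq_order.trans)
  then have "subseq (p @ [c]) (word (Suc h))"
    unfolding word.simps by (rule subseq_snoc) (simp add: assms(4))
  then show ?thesis
    using word_mono[OF Suc_leI[OF assms(3)]] by (rule subseq_order.trans)
qed

lemma gap_x: "x \<in> set (gap (j * N + w))"
  using room by (simp add: gap_eq row_gap_def)

lemma gap_vs:
  assumes "v \<in> set vs" and "age j < 2 * w"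
  shows "v \<in> set (gap (j * N + offset (age j)))"
proof -
  have "gap (j * N + offset (age j)) = row_gap j (offset (age j))"
    using offset_le[OF assms(2)] room by (intro gap_eq) linarith
  then show ?thesis
    using assms unfolding row_gap_def by (simp only: set_append Un_iff if_True simp_thms)
qed

text \<open>If row \<open>j\<close> has no block at offset \<open>d\<close> or later, then row
  \<open>j + 1\<close> has one at offset at most \<open>d\<close>: either the offset restarts at 0
  after a skipped row, or it rises to the next value other than \<open>w\<close>, which cannot jump
  over \<open>d\<close>.\<close>

lemma next_vs:
  assumes "v \<in> set vs" and "d \<le> 2 * w" and "d \<noteq> w"
  obtains h where "j * N + d \<le> h" "h \<le> Suc j * N + d" "v \<in> set (gap h)"
proof (cases "age j < 2 * w \<and> d \<le> offset (age j)")
  case True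
  then have "offset (age j) \<le> N"
    using offset_le[of "age j"] room by linarith
  with True show thesis
    using gap_vs[OF assms(1), of j] by (intro that[of "j * N + offset (age j)"]) auto
next
  case False
  have "w > 0"
    using assms by auto
  then have "age (Suc j) < 2 * w \<and> offset (age (Suc j)) \<le> d"
    using False age_le[of j] assms(2,3) by (auto simp: age_Suc offset_def split: if_splits)
  then show thesis
    using gap_vs[OF assms(1), of "Suc j"] room assms(2)
    by (intro that[of "Suc j * N + offset (age (Suc j))"]) auto
qed

text \<open>A bound on the greedy position that depends only on the set of letters used. Charging
  \<open>x\<close> the flat amount \<open>Suc w\<close> moves the offset beyond the forbidden value
  \<open>w\<close>.\<close>

definition cost :: "'a list \<Rightarrow> nat" where
  "cost p = (card (set p \<inter> set bs) + card (set p \<inter> set vs)) * N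
     + card (set p \<inter> set vs) + (if x \<in> set p then Suc w else 0)"

lemma subseq_word_cost:
  assumes "distinct p" and "set p \<subseteq> set (x # vs @ bs)"
  shows "subseq p (word (cost p))"
  using assms
proof (induction p rule: rev_induct)
  case (snoc c p)
  define k where "k = card (set p \<inter> set bs)"
  define i where "i = card (set p \<inter> set vs)"
  have IH: "subseq p (word (cost p))"
    using snoc by auto
  have c: "c \<notin> set p" "c = x \<or> c \<in> set vs \<or> c \<in> set bs"
    using snoc by auto
  have "i \<le> w"
    unfolding i_def using card_mono[of "set vs" "set p \<inter> set vs"] length_vs card_length[of vs]
    by auto
  from c(2) consider (base) "c \<in> set bs" | (skip) "c \<in> set vs" | (x) "c = x"
    by blast
  then show ?case
  proof cases
    case base
    then have "c \<notin> set vs" "c \<noteq> x"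
      using distinct_letters by auto
    then have "cost (p @ [c]) = cost p + N"
      using base c(1) by (simp add: cost_def Int_insert_left)
    then show ?thesis
      using subseq_snoc_base[OF IH base c(1)] by simp
  next
    case skip
    then have "c \<notin> set bs" "c \<noteq> x"
      using distinct_letters by auto
    then have cost: "cost (p @ [c]) = cost p + N + 1"
      using skip c(1) by (simp add: cost_def Int_insert_left)
    have "set p \<inter> set vs \<subset> set vs"
      using skip c(1) by blast
    then have "i < card (set vs)"
      unfolding i_def by (intro psubset_card_mono) auto
    then have "i < w"
      using card_length[of vs] length_vs by linarith
    \<comment> \<open>The offset of position \<open>cost p\<close> in row \<open>k + i\<close>:
      below \<open>w\<close> before \<open>x\<close>, above \<open>w\<close> after it, because
      \<open>c\<close> is not yet counted in \<open>i\<close>.\<close>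
    define d where "d = i + (if x \<in> set p then Suc w else 0)"
    have "d \<le> 2 * w" "d \<noteq> w"
      using \<open>i < w\<close> by (auto simp: d_def)
    then obtain h where h: "(k + i) * N + d \<le> h" "h \<le> Suc (k + i) * N + d" "c \<in> set (gap h)"
      using next_vs skip by blast
    have "cost p = (k + i) * N + d"
      by (simp add: cost_def k_def i_def d_def)
    then show ?thesis
      using h cost by (intro subseq_snoc_gap[OF IH, of h]) auto
  next
    case x
    then have "c \<notin> set bs" "c \<notin> set vs" "x \<notin> set p"
      using distinct_letters c(1) by auto
    then have "cost p = (k + i) * N + i" "cost (p @ [c]) = (k + i) * N + i + Suc w"
      using x by (auto simp: cost_def k_def i_def)
    \<comment> \<open>As \<open>i \<le> w\<close>, the copy of \<open>x\<close> in the current row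
      still lies ahead.\<close>
    then show ?thesis
      using \<open>i \<le> w\<close> gap_x[of "k + i"] x
      by (intro subseq_snoc_gap[OF IH, of "(k + i) * N + w"]) auto
  qed
qed (simp add: cost_def)

section \<open>Length of the word\<close>

lemma length_word: "length (word q) = Suc q + (\<Sum>h<q. length (gap h))"
  by (induction q) auto

lemma row_length:
  "(\<Sum>h=j * N..<j * N + N. length (gap h)) \<le> Suc (if age j < 2 * w then w else 0)"
proof -
  have "(\<Sum>h=j * N..<j * N + N. length (gap h)) = (\<Sum>r=0..<N. length (gap (j * N + r)))"
    by (subst sum.atLeastLessThan_shift_0) simp
  also have "\<dots> = (\<Sum>r=0..<N. (if r = w then 1 else 0)
      + (if r = offset (age j) then (if age j < 2 * w then w else 0) else 0))"
    by (intro sum.cong) (auto simp: gap_eq row_gap_def length_vs)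
  also have "\<dots> \<le> Suc (if age j < 2 * w then w else 0)"
    by (simp add: sum.distrib)
  finally show ?thesis .
qed

lemma length_word_le:
  assumes "q \<le> m * N"
  shows "length (word q) + w * (m div Suc (2 * w)) \<le> Suc q + m + w * m"
proof -
  \<comment> \<open>Rounding up to \<open>m\<close> whole rows permits counting row by row.\<close>
  have "(\<Sum>h<q. length (gap h)) \<le> (\<Sum>h<m * N. length (gap h))"
    using assms by (intro sum_mono2) auto
  also have "\<dots> = (\<Sum>j<m. \<Sum>h=j * N..<j * N + N. length (gap h))"
    by (rule sum.nat_group[symmetric])
  also have "\<dots> \<le> (\<Sum>j<m. Suc (if age j < 2 * w then w else 0))"
    by (intro sum_mono row_length)
  also have "\<dots> = m + (\<Sum>j<m. if age j < 2 * w then w else 0)"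
    by (simp only: Suc_eq_plus1_left sum.distrib) simp
  finally show ?thesis
    using sum_skipped_rows[of "2 * w" w m] unfolding length_word age_def by linarith
qed

lemma supersequence_word:
  "supersequence (set (x # vs @ bs)) (word ((Suc N + w) * N + 2 * w + 1))"
  unfolding supersequence_def
proof (intro conjI ballI set_word)
  fix p assume "p \<in> permutations_of_set (set (x # vs @ bs))"
  then have p: "set p = set (x # vs @ bs)" "distinct p"
    by (auto simp: permutations_of_set_def)
  have "set p \<inter> set bs = set bs" "set p \<inter> set vs = set vs" "x \<in> set p"
    using p by auto
  moreover have "card (set bs) = Suc N" "card (set vs) = w"
    using distinct_letters length_bs length_vs by (auto simp: distinct_card)
  ultimately have "cost p = (Suc N + w) * N + 2 * w + 1"
    by (simp add: cost_def)
  then show "subseq p (word ((Suc N + w) * N + 2 * w + 1))"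
    using subseq_word_cost[of p] p by simp
qed simp

end

theorem theorem26:
  fixes s m :: nat and A :: "'a set"
  assumes "s \<ge> 1" and "m \<ge> 4 * s + 2"
    and "finite A" and "card A = m"
  shows "\<exists>w. supersequence A w \<and>
    int (length w) \<le>
      \<lceil>(real m)^2 - (5 * real s - 3) / (2 * real s - 1) * real m
        + (4 * (real s)^3 - 10 * (real s)^2 + 21 * real s - 11) / (2 * real s - 1)\<rceil>"
proof -
  obtain w where s: "s = Suc w"
    using assms(1) by (cases s) auto
  obtain N where m: "m = N + w + 2"
    using assms(2) s le_iff_add[of "w + 2" m] by (auto simp: add_ac)
  obtain xs where xs: "set xs = A" "distinct xs" "length xs = m"
    using assms(3,4) finite_distinct_list distinct_card by metis
  then obtain x ys where ys: "xs = x # ys"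
    using m by (cases xs) auto
  define vs where "vs = take w ys"
  define bs where "bs = drop w ys"
  have split: "xs = x # vs @ bs"
    by (simp add: ys vs_def bs_def)
  \<comment> \<open>The bound \<open>m \<ge> 4 * s + 2\<close> gives
    \<open>N \<ge> 3 * w + 4\<close>, hence \<open>room\<close>.\<close>
  interpret skip_word bs vs x N w
    using xs ys m assms(2) s split by unfold_locales (auto simp: vs_def bs_def)
  let ?q = "(Suc N + w) * N + 2 * w + 1"
  have "supersequence A (word ?q)"
    using supersequence_word split xs(1) by simp
  moreover have "int (length (word ?q)) \<le>
      \<lceil>(real m)^2 - (5 * real s - 3) / (2 * real s - 1) * real m
        + (4 * (real s)^3 - 10 * (real s)^2 + 21 * real s - 11) / (2 * real s - 1)\<rceil>"
  proof -
    define f where "f = m div Suc (2 * w)"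
    define W where "W = real w"
    define M where "M = real m"
    have "m \<le> Suc (2 * w) * f + 2 * w"
      unfolding f_def using mult_div_mod_eq[of "Suc (2 * w)" m] mod_less_divisor[of "Suc (2 * w)" m]
      by linarith
    then have "real m \<le> real (Suc (2 * w) * f + 2 * w)"
      by (rule of_nat_mono)
    then have f: "W * (M - 2 * W) \<le> W * ((2 * W + 1) * real f)"
      by (intro mult_left_mono) (auto simp: W_def M_def algebra_simps)
    \<comment> \<open>Here \<open>?q\<close> is \<open>m - 1\<close> rows plus
      \<open>2 * w + 1\<close> positions, which fit in one more row by \<open>room\<close>.\<close>
    have "?q \<le> m * N"
      using room by (simp add: m algebra_simps)
    then have "length (word ?q) + w * f \<le> Suc ?q + m + w * m"
      unfolding f_def by (rule length_word_le)
    then have "real (length (word ?q) + w * f) \<le> real (Suc ?q + m + w * m)"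
      by (rule of_nat_mono)
    moreover have "real N = M - W - 2"
      by (simp add: m M_def W_def)
    ultimately have "real (length (word ?q)) \<le> M\<^sup>2 - 2 * M + 3 * W + 4 - W * real f"
      by (simp add: W_def[symmetric] M_def[symmetric] algebra_simps power2_eq_square)
    also have "\<dots> \<le> M\<^sup>2 - (5 * real s - 3) / (2 * real s - 1) * M
        + (4 * (real s)^3 - 10 * (real s)^2 + 21 * real s - 11) / (2 * real s - 1)"
    proof -
      \<comment> \<open>Exactly the slack left once denominators are cleared and the bound
        \<open>f\<close> is inserted; its sign relies on \<open>W\<close> being a natural
        number.\<close>
      have "0 \<le> 2 * W * ((2 * W - 1) * (W - 1))"
        by (cases "w = 0") (auto simp: W_def)
      then have "(3 * W + 4 - 2 * M - W * real f) * (2 * W + 1)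
          \<le> 4 * (W + 1)^3 - 10 * (W + 1)^2 + 21 * (W + 1) - 11 - (5 * (W + 1) - 3) * M"
        using f by (simp add: algebra_simps power2_eq_square power3_eq_cube)
      then have "3 * W + 4 - 2 * M - W * real f
          \<le> (4 * (W + 1)^3 - 10 * (W + 1)^2 + 21 * (W + 1) - 11 - (5 * (W + 1) - 3) * M) / (2 * W + 1)"
        by (subst pos_le_divide_eq) (auto simp: W_def)
      also have "\<dots> = (4 * (W + 1)^3 - 10 * (W + 1)^2 + 21 * (W + 1) - 11) / (2 * W + 1)
          - (5 * (W + 1) - 3) / (2 * W + 1) * M"
        unfolding diff_divide_distrib[of _ "(5 * (W + 1) - 3) * M"] by simp
      also have "2 * W + 1 = 2 * real s - 1"
        by (simp add: s W_def)
      also have "W + 1 = real s"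
        by (simp add: s W_def)
      finally show ?thesis
        by linarith
    qed
    finally show ?thesis
      unfolding M_def le_ceiling_iff of_int_of_nat_eq by linarith
  qed
  ultimately show ?thesis
    by blast
qed

end
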